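(* For any $\gamma>0$, $t>0$ and given model parameter $\theta$, let $p$ be the current sample distribution at time $t$ and denote $$q^\star=\arg\max_{q\in\mathscr{P}_o(G_0)}\mathcal{L}(\theta,q)-\gamma\,\mathcal{GW}_{G_0}^2(p,q),$$ the solution of the one-step (time-discretized) gradient flow problem at time $t$. Let $\epsilon=\mathcal{GW}_{G_0}^2(p,q^\star)$. Then $$\max_{q\in\mathscr{P}_o(G_0)}\mathcal{L}(\theta,q)-\gamma\,\mathcal{GW}_{G_0}^2(p,q)\;=\;\max_{q:\ \mathcal{GW}_{G_0}^2(p,q)\le \epsilon}\mathcal{L}(\theta,q).$$ Here the left-hand side is the one-step gradient flow at time $t$, and the right-hand side is the worst-case distribution within a local distribution set.
   Context: Graph. $G_0=(V,E,W)$ is a weighted finite graph with node set $V$ (nodes indexed by $1,\dots,N$), edge set $E$, and edge weights $W=(w_{ij})_{(i,j)\in E}$. Objective. $\{(x_i,y_i)\}_{i=1}^N$ is the source data set indexed by the nodes, $f_\theta$ is a prediction model (a graph neural network) with parameter $\theta$, $\ell$ is the loss function, and $\beta$ is a hyper-parameter (the coefficient of the entropy penalty). For $q=(q_1,\dots,q_N)$, $$\mathcal L(\theta,q)=\sum_{i=1}^N q_i\,\ell(f_\theta(x_i),y_i)-\beta\sum_{i=1}^N q_i\log q_i .$$ Probability set. $\mathcal P(G_0)=\{p=(p_i)_{i=1}^N:\sum_{i=1}^N p_i=1,\ p_i\ge 0\}$, and $\mathscr P_o(G_0)$ is its interior. Velocity fields and divergence. A velocity field on $G_0$ is a matrix $v=(v_{ij})\in\mathbb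 R^{N\times N}$ with $v_{ij}=-v_{ji}$ if $(i,j)\in E$ and $v_{ij}=0$ otherwise. The interpolation function used is the upwind one, $\xi_{ij}(p)=\mathbb I(v_{ij}>0)\,p_j+\mathbb I(v_{ij}\le 0)\,p_i$, where $\mathbb I$ is the indicator function. The divergence is $$\mathrm{div}_{G_0}(pv)=-\Big(\sum_{j\in V:(i,j)\in E}\sqrt{w_{ij}}\,v_{ij}\,\xi_{ij}(p)\Big)_{i=1}^N\in\mathbb R^N .$$ Discrete geometric Wasserstein distance. For $p^0,p^1\in\mathscr P_o(G_0)$, $$\mathcal{GW}_{G_0}^2(p^0,p^1)=\inf_v\left\{\int_0^1\frac12\sum_{(i,j)\in E}\xi_{ij}(p(t))\,v_{ij}^2\,dt:\ \frac{dp}{dt}+\mathrm{div}_{G_0}(pv)=0,\ p(0)=p^0,\ p(1)=p^1\right\},$$ where the infimum is over all velocity fields on $G_0$ and $p(t):[0,1]\to\mathscr P_o(G_0)$ is a continuously differentiable curve. One-step gradient flow. With time step $\tau$, the time-discretized gradient flow $q^\tau:[0,T]\to\mathscr P_o(G_0)$ of $-\mathcal L(\theta,\cdot)$ is $q^\tau(t+\tau)\leftarrow\arg\max_{q\in\mathscr P_o(G_0)}\mathcal L(\theta,q)-\frac{1}{2\tau}\mathcal{GW}_{G_0}^2(q^\tau(t),q)$; in the claim, $p$ plays the role of $q^\tau(t)$ and $\gamma$ that of $\frac{1}{2\tau}$.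
   Formalization: The stated equality of maximum values fails when ε>0. Proved instead: the left maximum equals the right maximum minus γε; q* solves the right problem, whose solutions are the left maximizers at squared distance ε; if q* is the unique left maximizer, both problems have the same solutions. *)

theory Defs
  imports "HOL-Analysis.Analysis"
begin

section \<open>Graphs and probability vectors\<close>

text \<open>
  The finite index type \<open>'n\<close> is the node set. An undirected edge is present in \<open>E\<close> as
  two ordered pairs, so sums over \<open>E\<close> run over ordered pairs. Entries of \<open>W\<close> outside
  \<open>E\<close> are never used.
\<close>

definition weighted_graph :: "('n::finite \<times> 'n) set \<Rightarrow> real^'n^'n \<Rightarrow> bool" where
  "weighted_graph E W \<longleftrightarrow>
     sym E \<and> (\<forall>(i, j) \<in> E. 0 \<le> W $ i $ j \<and> W $ i $ j = W $ j $ i)"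

definition prob_set :: "(real^'n::finite) set" where
  "prob_set = {p. (\<Sum>i\<in>UNIV. p $ i) = 1 \<and> (\<forall>i. 0 \<le> p $ i)}"

text \<open>
  The probability set has empty interior in \<open>real^'n\<close>; its interior is meant relative to
  the hyperplane of vectors with coordinate sum 1.
\<close>

definition prob_interior :: "(real^'n::finite) set" where
  "prob_interior = rel_interior prob_set"

lemma prob_interior_eq:
  "prob_interior = {p :: real^'n::finite. (\<Sum>i\<in>UNIV. p $ i) = 1 \<and> (\<forall>i. 0 < p $ i)}"
proof -
  define S where "S = {p :: real^'n. \<forall>i. 0 \<le> p $ i}"
  define T where "T = {p :: real^'n. (\<Sum>i\<in>UNIV. p $ i) = 1}"
  have int: "interior S = {p. \<forall>i. 0 < p $ i}"
  proof
    have "p \<in> interior {x :: real^'n. x $ i \<ge> 0}" if "p \<in> interior S" for p i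
      using that interior_mono[of S "{x. x $ i \<ge> 0}"] by (auto simp: S_def)
    then show "interior S \<subseteq> {p. \<forall>i. 0 < p $ i}"
      by auto
    have "open (\<Inter>i. {p :: real^'n. 0 < p $ i})"
      by (intro open_INT) (auto intro!: open_Collect_less continuous_intros)
    moreover have "(\<Inter>i. {p :: real^'n. 0 < p $ i}) = {p. \<forall>i. 0 < p $ i}"
      by auto
    ultimately show "{p. \<forall>i. 0 < p $ i} \<subseteq> interior S"
      by (intro interior_maximal) (auto simp: S_def less_imp_le)
  qed
  have conv: "convex S"
    by (auto simp: S_def convex_def)
  have aff: "affine T"
    by (auto simp: T_def affine_def sum.distrib simp flip: sum_distrib_left)
  have unif: "(\<chi> i. 1 / real CARD('n)) \<in> interior S \<inter> T"
    by (simp add: int T_def)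
  have rel: "rel_interior S = interior S"
    using unif by (intro rel_interior_nonempty_interior) auto
  have "rel_interior (S \<inter> T) = interior S \<inter> T"
    using convex_affine_rel_interior_Int[OF conv aff] unif rel by auto
  moreover have "prob_set = S \<inter> T"
    by (auto simp: prob_set_def S_def T_def)
  ultimately show ?thesis
    by (auto simp: prob_interior_def int T_def)
qed

section \<open>The discrete geometric Wasserstein distance\<close>

definition velocity_field :: "('n::finite \<times> 'n) set \<Rightarrow> real^'n^'n \<Rightarrow> bool" where
  "velocity_field E v \<longleftrightarrow>
     (\<forall>i j. ((i, j) \<in> E \<longrightarrow> v $ i $ j = - v $ j $ i) \<and> ((i, j) \<notin> E \<longrightarrow> v $ i $ j = 0))"

definition upwind :: "real^'n^'n \<Rightarrow> real^'n \<Rightarrow> 'n::finite \<Rightarrow> 'n \<Rightarrow> real" where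
  "upwind v p i j = (if v $ i $ j > 0 then p $ j else p $ i)"

definition graph_div ::
  "('n::finite \<times> 'n) set \<Rightarrow> real^'n^'n \<Rightarrow> real^'n \<Rightarrow> real^'n^'n \<Rightarrow> real^'n" where
  "graph_div E W p v =
     (\<chi> i. - (\<Sum>j | (i, j) \<in> E. sqrt (W $ i $ j) * v $ i $ j * upwind v p i j))"

text \<open>
  Curves \<open>p\<close> and time-dependent velocity fields \<open>v\<close> matter only on \<open>{0..1}\<close>; derivatives
  at the end points are one-sided. Measurability of \<open>v\<close> makes the kinetic energy below a
  genuine Lebesgue integral.
\<close>

definition admissible_path ::
  "('n::finite \<times> 'n) set \<Rightarrow> real^'n^'n \<Rightarrow> real^'n \<Rightarrow> real^'n \<Rightarrow>
     (real \<Rightarrow> real^'n) \<Rightarrow> (real \<Rightarrow> real^'n^'n) \<Rightarrow> bool" where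
  "admissible_path E W p0 p1 p v \<longleftrightarrow>
     (\<forall>s\<in>{0..1}. p s \<in> prob_interior) \<and>
     (\<forall>s\<in>{0..1}. velocity_field E (v s)) \<and>
     v \<in> borel_measurable (lebesgue_on {0..1}) \<and>
     (\<exists>p'. continuous_on {0..1} p' \<and>
        (\<forall>s\<in>{0..1}. (p has_vector_derivative p' s) (at s within {0..1}) \<and>
           p' s + graph_div E W (p s) (v s) = 0)) \<and>
     p 0 = p0 \<and> p 1 = p1"

definition kinetic_energy ::
  "('n::finite \<times> 'n) set \<Rightarrow> (real \<Rightarrow> real^'n) \<Rightarrow> (real \<Rightarrow> real^'n^'n) \<Rightarrow> ennreal" where
  "kinetic_energy E p v =
     (\<integral>\<^sup>+ s. ennreal (1 / 2 * (\<Sum>(i, j) \<in> E. upwind (v s) (p s) i j * (v s $ i $ j)\<^sup>2))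
        \<partial>lebesgue_on {0..1})"

text \<open>
  The squared distance. It is infinite when no admissible path joins the two vectors, as
  can happen on a disconnected graph.
\<close>

definition GW2 ::
  "('n::finite \<times> 'n) set \<Rightarrow> real^'n^'n \<Rightarrow> real^'n \<Rightarrow> real^'n \<Rightarrow> ennreal" where
  "GW2 E W p0 p1 = Inf {kinetic_energy E p v | p v. admissible_path E W p0 p1 p v}"

section \<open>The objective\<close>

definition objective ::
  "('n::finite \<Rightarrow> 'x) \<Rightarrow> ('n \<Rightarrow> 'y) \<Rightarrow> ('t \<Rightarrow> 'x \<Rightarrow> 'z) \<Rightarrow> ('z \<Rightarrow> 'y \<Rightarrow> real) \<Rightarrow> real \<Rightarrow>
     't \<Rightarrow> real^'n \<Rightarrow> real" where
  "objective x y f loss \<beta> \<theta> q =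
     (\<Sum>i\<in>UNIV. q $ i * loss (f \<theta> (x i)) (y i)) - \<beta> * (\<Sum>i\<in>UNIV. q $ i * ln (q $ i))"

text \<open>
  Extended-real valued: \<open>-\<infinity>\<close> where the squared distance is infinite.
\<close>

definition penalized_objective ::
  "('n::finite \<times> 'n) set \<Rightarrow> real^'n^'n \<Rightarrow> (real^'n \<Rightarrow> real) \<Rightarrow> real \<Rightarrow> real^'n \<Rightarrow> real^'n \<Rightarrow> ereal" where
  "penalized_objective E W L \<gamma> p q = ereal (L q) - ereal \<gamma> * enn2ereal (GW2 E W p q)"

definition GW_ball ::
  "('n::finite \<times> 'n) set \<Rightarrow> real^'n^'n \<Rightarrow> real^'n \<Rightarrow> ennreal \<Rightarrow> (real^'n) set" where
  "GW_ball E W p \<epsilon> = {q \<in> prob_interior. GW2 E W p q \<le> \<epsilon>}"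

definition argmax_set :: "('a \<Rightarrow> 'b::linorder) \<Rightarrow> 'a set \<Rightarrow> 'a set" where
  "argmax_set F A = {a. is_arg_max F (\<lambda>a. a \<in> A) a}"

end

theory Submission
  imports Defs
begin

text \<open>
  This is the exchange argument for Lagrangian penalties. A maximizer \<open>a\<close> of \<open>L - \<gamma> D\<close> beats
  every point with \<open>D \<le> D a\<close> in \<open>L\<close>, since such a point pays no larger penalty; conversely
  a maximizer of \<open>L\<close> under \<open>D \<le> D a\<close> can tie with \<open>a\<close> only if it pays the same penalty.
  The constant path gives the current distribution distance \<open>0\<close> from itself, so the penalized
  maximum, and hence \<open>\<epsilon>\<close>, is finite.
\<close>

lemma argmax_set_iff: "a \<in> argmax_set F A \<longleftrightarrow> a \<in> A \<and> (\<forall>b\<in>A. F b \<le> F a)"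
  by (auto simp: argmax_set_def is_arg_max_def not_less)

lemma SUP_argmax_set:
  fixes F :: "'a \<Rightarrow> 'b::complete_linorder"
  assumes "a \<in> argmax_set F A"
  shows "(SUP b\<in>A. F b) = F a"
  using assms by (auto simp: argmax_set_iff intro!: antisym SUP_least SUP_upper)

text \<open>With both distances finite the penalties are real numbers, so comparisons of penalized
  values pass to linear arithmetic over the reals.\<close>

lemma penalized_le_iff:
  fixes d e :: ennreal
  assumes "d < \<infinity>" "e < \<infinity>"
  shows "ereal l - ereal \<gamma> * enn2ereal d \<le> ereal m - ereal \<gamma> * enn2ereal e \<longleftrightarrow>
    l - \<gamma> * enn2real d \<le> m - \<gamma> * enn2real e"
  using assms by (cases d; cases e) auto

text \<open>The condition \<open>D q = D a\<close> on the right is essential: another penalized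
  maximizer may trade a different \<open>L\<close> against a different \<open>D\<close>, and then it
  leaves the ball or fails to maximize \<open>L\<close> there.\<close>

lemma argmax_set_penalized:
  fixes L :: "'a \<Rightarrow> real" and D :: "'a \<Rightarrow> ennreal" and \<gamma> :: real
  defines "J \<equiv> \<lambda>q. ereal (L q) - ereal \<gamma> * enn2ereal (D q)"
  assumes \<gamma>: "\<gamma> > 0" and a: "a \<in> argmax_set J A" and fin: "D a < \<infinity>"
  shows "argmax_set L {q\<in>A. D q \<le> D a} = {q \<in> argmax_set J A. D q = D a}"
proof -
  have le: "L q - \<gamma> * enn2real (D q) \<le> L a - \<gamma> * enn2real (D a)"
    if "q \<in> A" "D q \<le> D a" for q
    using that a fin penalized_le_iff[of "D q" "D a" "L q" \<gamma> "L a"] le_less_trans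
    by (auto simp: argmax_set_iff J_def)
  have pen: "\<gamma> * enn2real (D q) \<le> \<gamma> * enn2real (D a)" if "D q \<le> D a" for q
    using that fin \<gamma> by (intro mult_left_mono enn2real_mono) auto
  have ball: "L q \<le> L a" if "q \<in> A" "D q \<le> D a" for q
    using le[OF that] pen[OF that(2)] by linarith
  show ?thesis
  proof (intro set_eqI iffI)
    fix q assume "q \<in> argmax_set L {q\<in>A. D q \<le> D a}"
    then have q: "q \<in> A" "D q \<le> D a" "L a \<le> L q"
      using a by (auto simp: argmax_set_iff)
    have "L q = L a" "\<gamma> * enn2real (D q) = \<gamma> * enn2real (D a)"
      using q(3) ball[OF q(1,2)] le[OF q(1,2)] pen[OF q(2)] by linarith+
    \<comment> \<open>As \<open>enn2real\<close> sends \<infinity> to 0, equal real values give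
      equal distances only between finite ones.\<close>
    moreover have "D q < \<infinity>"
      using q(2) fin by (rule le_less_trans)
    ultimately have "D q = D a"
      using \<gamma> fin by (cases "D q"; cases "D a") auto
    then show "q \<in> {q \<in> argmax_set J A. D q = D a}"
      using q(1) a \<open>L q = L a\<close> by (auto simp: argmax_set_iff J_def)
  next
    fix q assume "q \<in> {q \<in> argmax_set J A. D q = D a}"
    then have q: "q \<in> A" "D q = D a" "J a \<le> J q"
      using a by (auto simp: argmax_set_iff)
    \<comment> \<open>Equal finite penalties cancel.\<close>
    then have "L a \<le> L q"
      using fin penalized_le_iff[of "D a" "D q" "L a" \<gamma> "L q"] by (simp add: J_def)
    then show "q \<in> argmax_set L {q\<in>A. D q \<le> D a}"
      using q ball by (force simp: argmax_set_iff)
  qed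
qed

lemma GW2_self:
  assumes "p \<in> prob_interior"
  shows "GW2 E W p p = 0"
proof -
  \<comment> \<open>Hence the constant curve at rest solves the continuity equation with derivative
    0, the witness used next.\<close>
  have "graph_div E W p 0 = 0"
    by (simp add: graph_div_def vec_eq_iff)
  then have "admissible_path E W p p (\<lambda>_. p) (\<lambda>_. 0)"
    unfolding admissible_path_def using assms
    by (auto simp: velocity_field_def intro!: exI[of _ "\<lambda>_. 0"])
  moreover have "kinetic_energy E (\<lambda>_. p) (\<lambda>_. 0) = 0"
    by (simp add: kinetic_energy_def)
  ultimately have "GW2 E W p p \<le> 0"
    unfolding GW2_def by (metis (mono_tags, lifting) Inf_lower mem_Collect_eq)
  then show ?thesis
    by simp
qed

theorem theorem1:
  fixes E :: "('n::finite \<times> 'n) set" and W :: "real^'n^'n"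
    and x :: "'n \<Rightarrow> 'x" and y :: "'n \<Rightarrow> 'y"
    and f :: "'t \<Rightarrow> 'x \<Rightarrow> 'z" and loss :: "'z \<Rightarrow> 'y \<Rightarrow> real"
    and \<beta> \<gamma> t T :: real and \<theta> :: 't
    and flow :: "real \<Rightarrow> real^'n" and p q_star :: "real^'n" and \<epsilon> :: ennreal
  defines "L \<equiv> objective x y f loss \<beta> \<theta>"
  defines "J \<equiv> penalized_objective E W L \<gamma> p"
  assumes "weighted_graph E W"
    and "\<gamma> > 0"
    and "0 < t" and "t \<le> T" and "flow ` {0..T} \<subseteq> prob_interior" and "p = flow t"
    and "q_star \<in> argmax_set J prob_interior"
    and "\<epsilon> = GW2 E W p q_star"
  shows "\<epsilon> < \<infinity> \<and>
    q_star \<in> argmax_set L (GW_ball E W p \<epsilon>) \<and>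
    argmax_set L (GW_ball E W p \<epsilon>) = {q \<in> argmax_set J prob_interior. GW2 E W p q = \<epsilon>} \<and>
    (argmax_set J prob_interior = {q_star} \<longrightarrow>
       argmax_set J prob_interior = argmax_set L (GW_ball E W p \<epsilon>)) \<and>
    (SUP q\<in>prob_interior. J q) =
      (SUP q\<in>GW_ball E W p \<epsilon>. ereal (L q)) - ereal \<gamma> * enn2ereal \<epsilon>"
proof -
  have p: "p \<in> prob_interior"
    using assms by auto
  have fin: "\<epsilon> < \<infinity>"
  proof (rule ccontr)
    assume "\<not> \<epsilon> < \<infinity>"
    then have "J q_star = -\<infinity>"
      using assms by (simp add: J_def penalized_objective_def less_top[symmetric])
    moreover have "J p \<le> J q_star" "J p = ereal (L p)"
      using assms p by (auto simp: argmax_set_iff penalized_objective_def GW2_self zero_ennreal.rep_eq)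
    ultimately show False
      by simp
  qed
  have J: "J = (\<lambda>q. ereal (L q) - ereal \<gamma> * enn2ereal (GW2 E W p q))"
    by (simp add: J_def penalized_objective_def fun_eq_iff)
  have eq: "argmax_set L (GW_ball E W p \<epsilon>) = {q \<in> argmax_set J prob_interior. GW2 E W p q = \<epsilon>}"
    using argmax_set_penalized[of \<gamma> q_star L "GW2 E W p" prob_interior] assms(4,9,10) fin
    unfolding J GW_ball_def by simp
  then have q: "q_star \<in> argmax_set L (GW_ball E W p \<epsilon>)"
    using assms by simp
  \<comment> \<open>The embedding into \<open>ereal\<close> preserves order, hence maximizers, and
    provides the complete order in which suprema are taken.\<close>
  then have "q_star \<in> argmax_set (\<lambda>q. ereal (L q)) (GW_ball E W p \<epsilon>)"
    by (simp add: argmax_set_iff)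
  then have "(SUP q\<in>GW_ball E W p \<epsilon>. ereal (L q)) = ereal (L q_star)"
    by (rule SUP_argmax_set)
  moreover have "(SUP q\<in>prob_interior. J q) = J q_star"
    using assms by (intro SUP_argmax_set)
  \<comment> \<open>Both suprema are attained at \<open>q_star\<close>, so they differ exactly by
    its penalty.\<close>
  ultimately have "(SUP q\<in>prob_interior. J q) =
      (SUP q\<in>GW_ball E W p \<epsilon>. ereal (L q)) - ereal \<gamma> * enn2ereal \<epsilon>"
    using assms(10) by (simp add: J)
  moreover have "argmax_set J prob_interior = {q_star} \<longrightarrow>
      argmax_set J prob_interior = argmax_set L (GW_ball E W p \<epsilon>)"
    using eq assms(10) by auto
  ultimately show ?thesis
    using fin eq q by blast
qed

end
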